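(* Let $C_n(t)$ denote the Narayana polynomials and $F_n(x,s)$ the Fibonacci polynomials. Then for all integers $n\ge 0$, as polynomials in $t$, $$\det\bigl(C_{i+j+1}(t)+C_{i+j+2}(t)\bigr)_{i,j=0}^{n-1}=(-1)^n\,t^{\binom n2}\,F_{n+1}(-t-2,-t).$$
   Context: The Narayana polynomials are $C_0(t)=1$ and $C_n(t)=\sum_{k=0}^{n}\binom nk\binom{n-1}{k}\frac{1}{k+1}t^k$ for $n>0$ (so $C_1=1$, $C_2=1+t$, $C_3=1+3t+t^2$). The Fibonacci polynomials are defined by $F_0(x,s)=0$, $F_1(x,s)=1$, $F_n(x,s)=xF_{n-1}(x,s)+sF_{n-2}(x,s)$ for $n\ge 2$. The determinant of the empty ($0\times 0$) matrix is $1$. *)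

theory Defs
  imports Jordan_Normal_Form.Determinant
begin

text \<open>Polynomials in \<open>t\<close> are elements of \<^typ>\<open>rat poly\<close>; the displayed coefficients involve division
  by \<open>k + 1\<close> (the quotients are in fact integers).\<close>

definition narayana_poly :: "nat \<Rightarrow> rat poly" where
  "narayana_poly n =
    (if n = 0 then 1
     else (\<Sum>k=0..n. monom (of_nat (n choose k) * of_nat ((n - 1) choose k) * (1 / of_nat (k + 1))) k))"

text \<open>The Fibonacci polynomials are given through their values: \<open>fib_poly n x s\<close> is \<open>F\<^sub>n(x, s)\<close> for
  \<open>x\<close>, \<open>s\<close> in an arbitrary commutative ring, so that polynomials can be substituted for them.\<close>

fun fib_poly :: "nat \<Rightarrow> 'a \<Rightarrow> 'a \<Rightarrow> 'a :: comm_ring_1" where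
  "fib_poly 0 x s = 0"
| "fib_poly (Suc 0) x s = 1"
| "fib_poly (Suc (Suc n)) x s = x * fib_poly (Suc n) x s + s * fib_poly n x s"

abbreviation tvar :: "rat poly" where
  "tvar \<equiv> [:0, 1:]"

end

theory Submission
  imports Defs
begin

text \<open>The shifted Narayana polynomials \<open>C\<^bsub>n+1\<^esub>(t)\<close> count Motzkin paths of length \<open>n\<close> whose level steps
  have weight \<open>1 + t\<close> and whose down steps have weight \<open>t\<close>. Let \<open>L\<close> be the unitriangular matrix whose
  entry \<open>(n, k)\<close> counts the paths of length \<open>n\<close> from height \<open>0\<close> to height \<open>k\<close>, and \<open>J\<close> the tridiagonal
  matrix of a single step. Splitting a path of length \<open>i + j\<close> after \<open>i\<close> steps, and reversing its
  second part, shows that the Hankel matrix of \<open>C\<^bsub>i+j+1\<^esub> + C\<^bsub>i+j+2\<^esub>\<close> factors as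
  \<open>L diag(t\<^sup>k) (1 + J) L\<^sup>T\<close>. The determinant is therefore \<open>t\<close> to the power \<open>0 + 1 + \<dots> + (n - 1)\<close> times
  the tridiagonal determinant of \<open>1 + J\<close>, which satisfies the Fibonacci recurrence up to signs.\<close>

fun motzkin :: "'a::comm_ring_1 \<Rightarrow> nat \<Rightarrow> nat \<Rightarrow> 'a" where
  "motzkin t 0 k = (if k = 0 then 1 else 0)"
| "motzkin t (Suc n) k =
     (case k of 0 \<Rightarrow> 0 | Suc i \<Rightarrow> motzkin t n i) + (1 + t) * motzkin t n k + t * motzkin t n (Suc k)"

lemma motzkin_eq_0: "n < k \<Longrightarrow> motzkin t n k = 0"
  by (induction n arbitrary: k) (auto split: nat.splits)

lemma motzkin_diag: "motzkin t n n = 1"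
  by (induction n) (auto simp: motzkin_eq_0)

text \<open>The step operator is self-adjoint for the weights \<open>t\<^sup>k\<close>, up to a boundary term.\<close>

lemma motzkin_step_adjoint:
  "(\<Sum>k\<le>N. t ^ k * motzkin t (Suc m) k * motzkin t n k) + t ^ Suc N * motzkin t m N * motzkin t n (Suc N)
   = (\<Sum>k\<le>N. t ^ k * motzkin t m k * motzkin t (Suc n) k) + t ^ Suc N * motzkin t m (Suc N) * motzkin t n N"
proof (induction N)
  case 0
  show ?case by (simp add: algebra_simps)
next
  case (Suc N)
  then show ?case
    by (simp add: algebra_simps)
qed

text \<open>Self-adjointness moves one step at a time from the first path to the second. Since
  \<open>N\<close> is at least both lengths, the boundary terms vanish; once \<open>m = 0\<close>,
  only \<open>k = 0\<close> contributes.\<close>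

lemma motzkin_convolution:
  assumes "m + n \<le> N"
  shows "(\<Sum>k\<le>N. t ^ k * motzkin t m k * motzkin t n k) = motzkin t (m + n) 0"
  using assms
proof (induction m arbitrary: n)
  case 0
  have "(\<Sum>k\<le>N. t ^ k * motzkin t 0 k * motzkin t n k) = (\<Sum>k\<le>N. if k = 0 then motzkin t n 0 else 0)"
    by (intro sum.cong) auto
  then show ?case by simp
next
  case (Suc m)
  then show ?case
    using motzkin_step_adjoint[of t m n N] Suc.IH[of "Suc n"] by (simp add: motzkin_eq_0)
qed

text \<open>Terms with \<open>k > m\<close> vanish whatever \<open>n\<close> is. This covers the
  Hankel entries, where the second length \<open>Suc j\<close> can equal the matrix size.\<close>

lemma motzkin_convolution_lt:
  assumes "m < N"
  shows "(\<Sum>k<N. t ^ k * motzkin t m k * motzkin t n k) = motzkin t (m + n) 0"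
proof -
  have "(\<Sum>k<N. t ^ k * motzkin t m k * motzkin t n k) = (\<Sum>k\<le>N + n. t ^ k * motzkin t m k * motzkin t n k)"
    using assms by (intro sum.mono_neutral_left) (auto simp: motzkin_eq_0)
  then show ?thesis
    using motzkin_convolution[of m n "N + n" t] assms by simp
qed

text \<open>The reflection principle: \<open>(n choose k + j) * (n choose j)\<close> is the coefficient of \<open>t\<^sup>j\<close> in the weight
  of the unrestricted paths ending at height \<open>k\<close>, because a step has weight
  \<open>z + (1 + t) + t / z = (1 + z) (1 + t / z)\<close>.\<close>

lemma coeff_motzkin:
  "coeff (motzkin tvar n k) j = of_nat ((n choose (k + j)) * (n choose j))
     - (case j of 0 \<Rightarrow> 0 | Suc i \<Rightarrow> of_nat ((n choose (k + j + 1)) * (n choose i)))"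
proof (induction n arbitrary: k j)
  case 0
  show ?case by (cases j) auto
next
  case (Suc n)
  have shift: "coeff (tvar * p) j = (case j of 0 \<Rightarrow> 0 | Suc i \<Rightarrow> coeff p i)" for p j
    by (cases j) simp_all
  show ?case
    \<comment> \<open>Pascal's rule. For \<open>k = 0\<close> the absent up step is consistent: at
      height -1 the two products of the formula cancel.\<close>
    by (cases j; cases "j - 1"; cases k)
       (simp_all add: Suc.IH shift distrib_right algebra_simps del: mult_pCons_left)
qed

lemma coeff_narayana_poly_Suc:
  "coeff (narayana_poly (Suc n)) j = of_nat ((Suc n choose j) * (n choose j)) / of_nat (Suc j)"
proof -
  have "coeff (narayana_poly (Suc n)) j =
      (\<Sum>k = 0..Suc n. if k = j then of_nat ((Suc n choose k) * (n choose k)) / of_nat (Suc k) else 0)"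
    unfolding narayana_poly_def coeff_sum by (auto simp: coeff_sum intro!: sum.cong)
  then show ?thesis by (simp add: not_le binomial_eq_0)
qed

lemma of_nat_binomial_Suc:
  "of_nat (Suc k) * of_nat (n choose Suc k) =
    (of_nat n - of_nat k) * (of_nat (n choose k) :: 'a::field_char_0)"
  using gbinomial_mult_1[of "of_nat n :: 'a" k]
  by (simp add: binomial_gbinomial[symmetric] algebra_simps)

lemma narayana_poly_Suc_eq_motzkin: "narayana_poly (Suc n) = motzkin tvar n 0"
proof (rule poly_eqI)
  fix j
  show "coeff (narayana_poly (Suc n)) j = coeff (motzkin tvar n 0) j"
  proof (cases j)
    case 0
    then show ?thesis by (simp add: coeff_narayana_poly_Suc coeff_motzkin)
  next
    case (Suc i)
    define a b c x where "a = (of_nat (n choose i) :: rat)" and "b = (of_nat (n choose Suc i) :: rat)"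
      and "c = (of_nat (n choose Suc (Suc i)) :: rat)" and "x = (of_nat i :: rat)"
    have "(x + 1) * b = (of_nat n - x) * a" "(x + 2) * c = (of_nat n - x - 1) * b"
      using of_nat_binomial_Suc[of i n, where 'a = rat] of_nat_binomial_Suc[of "Suc i" n, where 'a = rat]
      unfolding a_def b_def c_def x_def by (simp_all add: algebra_simps)
    \<comment> \<open>Both right sides are now multiples of \<open>a * b\<close> with factors
      differing by 1, so \<open>n\<close> drops out on subtraction.\<close>
    then have "(x + 1) * b * b = (of_nat n - x) * a * b" "(x + 2) * c * a = (of_nat n - x - 1) * b * a"
      by simp_all
    then have "(a + b) * b = (b * b - c * a) * (x + 2)"
      by (simp add: algebra_simps)
    moreover have "x + 2 \<noteq> 0"
      unfolding x_def by (metis of_nat_add of_nat_eq_0_iff of_nat_numeral add_eq_0_iff_both_eq_0 zero_neq_numeral)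
    ultimately have "(a + b) * b / (x + 2) = b * b - c * a"
      by (simp add: divide_eq_eq)
    then show ?thesis
      unfolding coeff_narayana_poly_Suc coeff_motzkin Suc a_def b_def c_def x_def
      by (simp add: add.commute)
  qed
qed

text \<open>The matrix \<open>1 + J\<close> is the case \<open>d = t + 2\<close>,
  \<open>u = t\<close>: up steps give the subdiagonal, down steps the superdiagonal.\<close>

definition tridiag :: "'a::comm_ring_1 \<Rightarrow> 'a \<Rightarrow> nat \<Rightarrow> 'a mat" where
  "tridiag d u n = mat n n (\<lambda>(k, l). if l = k then d else if k = Suc l then 1 else if l = Suc k then u else 0)"

lemma tridiag_carrier [simp]: "tridiag d u n \<in> carrier_mat n n"
  by (simp add: tridiag_def)

text \<open>Expand along the first row, then the minor of \<open>u\<close> along its first column,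
  whose only nonzero entry is the 1 on top.\<close>

lemma det_tridiag_Suc_Suc:
  "det (tridiag d u (Suc (Suc n))) = d * det (tridiag d u (Suc n)) - u * det (tridiag d u n)"
proof -
  let ?A = "tridiag d u (Suc (Suc n))"
  let ?B = "mat_delete ?A 0 1"
  have A: "?A \<in> carrier_mat (Suc (Suc n)) (Suc (Suc n))" by simp
  have B: "?B \<in> carrier_mat (Suc n) (Suc n)" by (simp add: mat_delete_def tridiag_def)
  have minor: "mat_delete ?A 0 0 = tridiag d u (Suc n)" "mat_delete ?B 0 0 = tridiag d u n"
    by (intro eq_matI; auto simp: mat_delete_def tridiag_def)+
  have "det ?B = (\<Sum>i<Suc n. ?B $$ (i, 0) * cofactor ?B i 0)"
    by (rule laplace_expansion_column[OF B]) simp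
  also have "\<dots> = (\<Sum>i\<in>{0}. ?B $$ (i, 0) * cofactor ?B i 0)"
    by (rule sum.mono_neutral_right) (auto simp: mat_delete_def tridiag_def)
  also have "\<dots> = det (tridiag d u n)"
  proof -
    have "?B $$ (0, 0) = 1"
      by (simp add: mat_delete_def tridiag_def)
    then show ?thesis
      by (simp add: cofactor_def minor(2) del: One_nat_def)
  qed
  finally have detB: "det ?B = det (tridiag d u n)" .
  have "det ?A = (\<Sum>j<Suc (Suc n). ?A $$ (0, j) * cofactor ?A 0 j)"
    by (rule laplace_expansion_row[OF A]) simp
  also have "\<dots> = (\<Sum>j\<in>{0, 1}. ?A $$ (0, j) * cofactor ?A 0 j)"
    by (rule sum.mono_neutral_right) (auto simp: tridiag_def)
  also have "\<dots> = d * det (tridiag d u (Suc n)) - u * det ?B"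
    unfolding cofactor_def using minor(1) by (simp add: tridiag_def)
  finally show ?thesis by (simp only: detB)
qed

text \<open>The factor \<open>(-1) ^ n\<close> changes the sign of the one-step coefficient only,
  turning \<open>(- d, - u)\<close> into \<open>(d, - u)\<close>.\<close>

lemma det_tridiag: "det (tridiag d u n) = (-1) ^ n * fib_poly (n + 1) (- d) (- u)"
proof (induction n rule: induct_nat_012)
  case 0
  show ?case by (simp add: tridiag_def)
next
  case 1
  show ?case by (simp add: tridiag_def det_single)
next
  case (ge2 n)
  then show ?case by (simp add: det_tridiag_Suc_Suc algebra_simps)
qed

lemma tridiag_motzkin_row:
  assumes "j < n" "k < n"
  shows "(\<Sum>l<n. tridiag (t + 2) t n $$ (k, l) * motzkin t j l) = motzkin t j k + motzkin t (Suc j) k"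
proof -
  have "(\<Sum>l<n. tridiag (t + 2) t n $$ (k, l) * motzkin t j l) =
      (\<Sum>l<n. (if l = k then (t + 2) * motzkin t j l else 0)
        + (if k = Suc l then motzkin t j l else 0) + (if l = Suc k then t * motzkin t j l else 0))"
    using assms by (intro sum.cong) (auto simp: tridiag_def)
  \<comment> \<open>Truncation in the last row is harmless: \<open>motzkin t j n\<close> is 0
    because \<open>j < n\<close>.\<close>
  also have "\<dots> = (t + 2) * motzkin t j k + (case k of 0 \<Rightarrow> 0 | Suc i \<Rightarrow> motzkin t j i) + t * motzkin t j (Suc k)"
    using assms by (cases k) (auto simp: sum.distrib motzkin_eq_0)
  finally show ?thesis by (simp add: algebra_simps)
qed

lemma prod_power_lessThan: "(\<Prod>k<n. t ^ k) = (t :: 'a::comm_monoid_mult) ^ (n choose 2)"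
  by (induction n) (simp_all add: numeral_2_eq_2 power_add mult.commute)

lemma det_motzkin_hankel:
  "det (mat n n (\<lambda>(i, j). motzkin t (i + j) 0 + motzkin t (i + j + 1) 0))
    = t ^ (n choose 2) * det (tridiag (t + 2) t n)"
proof -
  define L where "L = mat n n (\<lambda>(i, k). motzkin t i k)"
  define D where "D = mat n n (\<lambda>(i, k). if i = k then t ^ k else 0)"
  have [simp]: "L \<in> carrier_mat n n" "D \<in> carrier_mat n n"
    by (simp_all add: L_def D_def)
  have detL: "det L = 1"
    by (subst det_lower_triangular[of n]) (auto simp: L_def motzkin_eq_0 motzkin_diag prod_list_diag_prod)
  have detD: "det D = t ^ (n choose 2)"
    by (subst det_lower_triangular[of n])
       (auto simp: D_def prod_list_diag_prod prod_power_lessThan atLeast0LessThan)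
  have "mat n n (\<lambda>(i, j). motzkin t (i + j) 0 + motzkin t (i + j + 1) 0) =
      L * (D * (tridiag (t + 2) t n * L\<^sup>T))" (is "?H = ?P")
  proof (rule eq_matI)
    fix i j assume "i < dim_row ?P" "j < dim_col ?P"
    then have ij: "i < n" "j < n" by (simp_all add: L_def)
    have TL: "(tridiag (t + 2) t n * L\<^sup>T) $$ (k, j) = motzkin t j k + motzkin t (Suc j) k" if "k < n" for k
    proof -
      have "(tridiag (t + 2) t n * L\<^sup>T) $$ (k, j) = (\<Sum>l<n. tridiag (t + 2) t n $$ (k, l) * motzkin t j l)"
        using that ij by (simp add: scalar_prod_def L_def tridiag_def atLeast0LessThan)
      then show ?thesis using tridiag_motzkin_row[OF ij(2) that] by simp
    qed
    have DTL: "(D * (tridiag (t + 2) t n * L\<^sup>T)) $$ (k, j) = t ^ k * (motzkin t j k + motzkin t (Suc j) k)"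
      if "k < n" for k
    proof -
      have "(D * (tridiag (t + 2) t n * L\<^sup>T)) $$ (k, j) =
          (\<Sum>l<n. D $$ (k, l) * (tridiag (t + 2) t n * L\<^sup>T) $$ (l, j))"
        using that ij by (simp add: scalar_prod_def L_def D_def tridiag_def atLeast0LessThan)
      also have "\<dots> = (\<Sum>l<n. if l = k then t ^ k * (motzkin t j k + motzkin t (Suc j) k) else 0)"
        using that by (intro sum.cong refl) (auto simp: D_def TL)
      finally show ?thesis using that by simp
    qed
    have "?P $$ (i, j) = (\<Sum>k<n. L $$ (i, k) * (D * (tridiag (t + 2) t n * L\<^sup>T)) $$ (k, j))"
      using ij by (simp add: scalar_prod_def L_def D_def tridiag_def atLeast0LessThan)
    also have "\<dots> = (\<Sum>k<n. motzkin t i k * (t ^ k * (motzkin t j k + motzkin t (Suc j) k)))"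
      using ij by (intro sum.cong refl) (simp only: lessThan_iff DTL, simp add: L_def)
    also have "\<dots> = (\<Sum>k<n. t ^ k * motzkin t i k * motzkin t j k)
        + (\<Sum>k<n. t ^ k * motzkin t i k * motzkin t (Suc j) k)"
      by (simp only: sum.distrib[symmetric] distrib_left mult_ac)
    also have "\<dots> = motzkin t (i + j) 0 + motzkin t (i + Suc j) 0"
      using ij by (simp only: motzkin_convolution_lt)
    finally show "?H $$ (i, j) = ?P $$ (i, j)" using ij by simp
  qed (simp_all add: L_def)
  moreover have "det ?P = det L * (det D * (det (tridiag (t + 2) t n) * det L\<^sup>T))"
    by (simp add: det_mult[of _ n] mult_carrier_mat[of _ n n])
  ultimately show ?thesis
    using detL detD by (simp add: det_transpose[of L n])
qed

theorem theorem4p1: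
  fixes n :: nat
  shows "det (mat n n (\<lambda>(i, j). narayana_poly (i + j + 1) + narayana_poly (i + j + 2)))
    = (-1) ^ n * tvar ^ (n choose 2) * fib_poly (n + 1) (- tvar - 2) (- tvar)"
proof -
  have "narayana_poly (m + 1) = motzkin tvar m 0" "narayana_poly (m + 2) = motzkin tvar (m + 1) 0" for m
    using narayana_poly_Suc_eq_motzkin[of m] narayana_poly_Suc_eq_motzkin[of "Suc m"] by simp_all
  moreover have "- (tvar + 2) = - tvar - 2"
    by (simp only: minus_add_distrib diff_conv_add_uminus)
  ultimately show ?thesis
    using det_motzkin_hankel[of n tvar] det_tridiag[of "tvar + 2" tvar n]
    by (simp only: mult_ac)
qed

end
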